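(* Let $G$ be a quasi-random tournament of order $n$ with vertex set $V$. If $G$ has diameter $2$ and there exists some constant $0<\varepsilon<1$ such that $s(x,y)\le\varepsilon n$ for all distinct $x,y\in V$, then $$(1+o(1))\log_2 n\le\zeta(G)\le\max\bigl(-2/(\log_2\varepsilon),\,2\bigr)\log_2 n,$$ where the asymptotics are as $n\to\infty$.
   Context: A tournament is a finite digraph with no loops in which each pair of distinct vertices is joined by exactly one arc. For distinct vertices $u,v$ of a tournament, $\chi(u,v)=1$ if $(u,v)$ is an arc and $\chi(u,v)=-1$ otherwise; $S(u,v)=\{z\in V\setminus\{u,v\}:\chi(u,z)=\chi(v,z)\}$ and $s(u,v)=|S(u,v)|$. Quasi-randomness is a property of a sequence of tournaments $G=G(n)$ with order $n\to\infty$ (as usual, the hypotheses are imposed on each $G$ in the sequence, with the same constant $\varepsilon$): $G$ is quasi-random (in the sense of Chung and Graham) if $\sum_{u,v\in V}|s(u,v)-n/2|=o(n^3)$, the sum being over pairs of distinct vertices. By a theorem of Chung and Graham this is equivalent to several other conditions, among them: for all $X\subseteq V$, the subtournament $G'=G[X]$ satisfies $\sum_{v\in X}|d^+_{G'}(v)-d^-_{G'}(v)|=o(n^2)$, where $d^+_{G'}$ and $d^-_{G'}$ denote out- and in-degree in $G'$. The diameter of a digraph is the maximum over ordered pairs $(u,v)$ of the length of a shortest directed path from $u$ to $v$; this length is denoted $d(u,v)$, with $d(u,v)=\infty$ if there is no such path. The Localization game with $k$ cops on a digraph $G$: an invisible robber first chooses a vertex; in each round the cops choose vertices $u_1,\dots,u_k$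 (any vertices, chosen afresh each round) and learn the distance vector $(d(u_1,x),\ldots,d(u_k,x))$, where $x$ is the robber's current vertex; then the robber stays at $x$ or moves along an arc $(x,y)$ to an out-neighbor $y$. The cops win if they have a strategy which, whatever the robber does, after finitely many rounds determines a unique possible vertex for the robber right after a probe (using all information received so far); otherwise the robber wins. The localization number $\zeta(G)$ is the least positive integer $k$ for which $k$ cops have a winning strategy. *)

theory Defs
  imports "Graph_Theory.Graph_Theory" "HOL-Library.Landau_Symbols"
begin

section \<open>Tournaments\<close>

text \<open>Parallel arcs are already excluded by \<^locale>\<open>digraph\<close>.\<close>

locale tournament = digraph +
  assumes one_arc:
    "\<lbrakk>u \<in> verts G; v \<in> verts G; u \<noteq> v\<rbrakk> \<Longrightarrow> (u \<rightarrow>\<^bsub>G\<^esub> v) \<noteq> (v \<rightarrow>\<^bsub>G\<^esub> u)"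

text \<open>Used only for distinct vertices of a tournament, where the second case means that
  the arc between the two vertices is \<open>(v, u)\<close>.\<close>

definition chi :: "('a,'b) pre_digraph \<Rightarrow> 'a \<Rightarrow> 'a \<Rightarrow> int" where
  "chi G u v = (if u \<rightarrow>\<^bsub>G\<^esub> v then 1 else - 1)"

definition same_set :: "('a,'b) pre_digraph \<Rightarrow> 'a \<Rightarrow> 'a \<Rightarrow> 'a set" where
  "same_set G u v = {z \<in> verts G - {u, v}. chi G u z = chi G v z}"

definition same_count :: "('a,'b) pre_digraph \<Rightarrow> 'a \<Rightarrow> 'a \<Rightarrow> nat" where
  "same_count G u v = card (same_set G u v)"

text \<open>The index \<open>i\<close> of the sequence is not the order of the tournament: the orders need only tend
  to infinity. Forcing \<open>G i\<close> to have exactly \<open>i\<close> vertices would make a hypothesis such as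
  ``every \<open>G i\<close> has diameter 2'' unsatisfiable, since it fails for the smallest orders.\<close>

definition quasi_random :: "(nat \<Rightarrow> ('a,'b) pre_digraph) \<Rightarrow> bool" where
  "quasi_random G \<longleftrightarrow>
     (\<forall>i. tournament (G i)) \<and>
     filterlim (\<lambda>i. card (verts (G i))) at_top sequentially \<and>
     (\<lambda>i. \<Sum>(u,v) \<in> {(u,v). u \<in> verts (G i) \<and> v \<in> verts (G i) \<and> u \<noteq> v}.
            \<bar>real (same_count (G i) u v) - real (card (verts (G i))) / 2\<bar>)
       \<in> o[sequentially](\<lambda>i. real (card (verts (G i))) ^ 3)"


section \<open>Distance and diameter\<close>

text \<open>With unit weights, the library's shortest-path weight is the least number of arcs
  of a directed walk, and \<open>\<infinity>\<close> if there is none.\<close>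

definition digraph_dist :: "('a,'b) pre_digraph \<Rightarrow> 'a \<Rightarrow> 'a \<Rightarrow> ereal" where
  "digraph_dist G u v = wf_digraph.\<mu> G (\<lambda>_. 1) u v"

definition diameter :: "('a,'b) pre_digraph \<Rightarrow> ereal" where
  "diameter G = (SUP (u,v) \<in> verts G \<times> verts G. digraph_dist G u v)"


section \<open>The Localization game\<close>

definition robber_play :: "('a,'b) pre_digraph \<Rightarrow> (nat \<Rightarrow> 'a) \<Rightarrow> bool" where
  "robber_play G x \<longleftrightarrow> x 0 \<in> verts G \<and> (\<forall>t. x (Suc t) = x t \<or> x t \<rightarrow>\<^bsub>G\<^esub> x (Suc t))"

text \<open>A cop strategy maps the list of the distance vectors received so far to the list of vertices
  probed next; the earlier probes need not be listed, as the strategy determines them.\<close>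

type_synonym 'a cop_strategy = "ereal list list \<Rightarrow> 'a list"

definition cop_strategy :: "('a,'b) pre_digraph \<Rightarrow> nat \<Rightarrow> 'a cop_strategy \<Rightarrow> bool" where
  "cop_strategy G k \<sigma> \<longleftrightarrow> (\<forall>h. length (\<sigma> h) = k \<and> set (\<sigma> h) \<subseteq> verts G)"

text \<open>The distance vectors received in rounds \<open>0, \<dots>, t - 1\<close>, where round \<open>i\<close> probes the robber
  at \<open>x i\<close>, before the move to \<open>x (Suc i)\<close>.\<close>

primrec answers :: "('a,'b) pre_digraph \<Rightarrow> 'a cop_strategy \<Rightarrow> (nat \<Rightarrow> 'a) \<Rightarrow> nat \<Rightarrow> ereal list list"
  where
    "answers G \<sigma> x 0 = []"
  | "answers G \<sigma> x (Suc t) =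
       answers G \<sigma> x t @ [map (\<lambda>u. digraph_dist G u (x t)) (\<sigma> (answers G \<sigma> x t))]"

text \<open>The vertices at which, right after the probe of round \<open>t\<close>, the robber may be located
  according to the information received by the cops when the robber actually plays \<open>x\<close>.\<close>

definition possible_positions ::
    "('a,'b) pre_digraph \<Rightarrow> 'a cop_strategy \<Rightarrow> (nat \<Rightarrow> 'a) \<Rightarrow> nat \<Rightarrow> 'a set" where
  "possible_positions G \<sigma> x t =
     {y t |y. robber_play G y \<and> answers G \<sigma> y (Suc t) = answers G \<sigma> x (Suc t)}"

definition cops_win :: "('a,'b) pre_digraph \<Rightarrow> nat \<Rightarrow> bool" where
  "cops_win G k \<longleftrightarrow>
     (\<exists>\<sigma>. cop_strategy G k \<sigma> \<and>
        (\<forall>x. robber_play G x \<longrightarrow> (\<exists>t v. possible_positions G \<sigma> x t = {v})))"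

text \<open>On a finite nonempty digraph some such \<open>k\<close> exists: probing all vertices wins at once.\<close>

definition localization_number :: "('a,'b) pre_digraph \<Rightarrow> nat" where
  "localization_number G = (LEAST k. 0 < k \<and> cops_win G k)"

end

theory Submission
  imports Defs
begin

text \<open>In a tournament of diameter two with vertex set \<open>V\<close>, \<open>\<bar>V\<bar> = n\<close>, a probe at \<open>u\<close> reveals of a robber elsewhere only
  whether \<open>u\<close> dominates him: one bit. Both bounds count what \<open>k\<close> such bits can tell.

  Upper bound. A probe at \<open>z\<close> fails to separate \<open>x\<close> from \<open>y\<close> only if \<open>z \<in> S(x, y)\<close>, which has at most
  \<open>q n\<close> elements for \<open>q = max \<epsilon> (1/2)\<close>. So \<open>k\<close> random probes leave at most \<open>q\<^sup>k n(n-1)/2\<close> pairs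
  unseparated on average. At \<open>k = \<lfloor>(-2 / log\<^sub>2 q) log\<^sub>2 n\<rfloor>\<close> this is below \<open>1\<close>, because
  \<open>q\<^sup>k \<le> q\<^sup>-\<^sup>1 n\<^sup>-\<^sup>2 \<le> 2 n\<^sup>-\<^sup>2\<close>; the last step is where \<open>q \<ge> 1/2\<close> enters and why the bound holds
  for every \<open>n\<close> and not only asymptotically. Some choice of \<open>k\<close> probes thus locates the robber in the
  first round. The average is taken one probe at a time in \<open>exists_list_confined_to_few\<close>.

  Lower bound. If the robber stays in a set \<open>B\<close> such that every vertex of \<open>B\<close> has more than
  \<open>2\<^sup>k + k\<close> out-neighbours in \<open>B\<close>, then by the pigeonhole principle two of his possible next positions are not probed
  and give the same \<open>k\<close> bits, whichever probes the cops choose; so he can always move to one of two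
  indistinguishable vertices of \<open>B\<close> (\<open>not_cops_win_if_out_degrees\<close>). Quasi-randomness supplies
  \<open>B\<close>: counting the triples \<open>(u, v, z)\<close> with \<open>z \<in> S(u, v)\<close> from the side of \<open>z\<close> expresses
  \<open>\<Sum> s(u, v)\<close> by \<open>\<Sum> (d\<^sup>+(z) - d\<^sup>-(z))\<^sup>2\<close> (\<open>sum_same_count\<close>), so that \<open>\<Sum> \<bar>s(u, v) - n/2\<bar> = o(n\<^sup>3)\<close> leaves
  only \<open>o(n)\<close> vertices of out-degree below \<open>n/4\<close>. With \<open>B\<close> the remaining vertices, all out-degrees inside
  \<open>B\<close> are at least \<open>n/8\<close> for large \<open>n\<close>, and the robber escapes from every \<open>k \<le> log\<^sub>2 n - 5\<close> cops.\<close>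

section \<open>Distances in tournaments of diameter two\<close>

lemma (in wf_digraph) digraph_dist_eq_INF_length:
  "digraph_dist G u v = (INF p \<in> {p. awalk u p v}. ereal (real (length p)))"
proof -
  have "awalk_cost (\<lambda>_. 1) p = real (length p)" for p :: "'b list"
    by (simp add: awalk_cost_def sum_list_triv)
  then show ?thesis
    by (simp add: digraph_dist_def \<mu>_def)
qed

lemma (in wf_digraph) digraph_dist_le_length:
  "awalk u p v \<Longrightarrow> digraph_dist G u v \<le> ereal (real (length p))"
  unfolding digraph_dist_eq_INF_length by (rule INF_lower) simp

lemma (in wf_digraph) digraph_dist_self:
  assumes "u \<in> verts G" shows "digraph_dist G u u = 0"
proof (rule antisym)
  have "awalk u [] u" using assms by (simp add: awalk_Nil_iff)
  from digraph_dist_le_length[OF this] show "digraph_dist G u u \<le> 0"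
    by (simp add: zero_ereal_def)
  show "0 \<le> digraph_dist G u u"
    unfolding digraph_dist_eq_INF_length by (rule INF_greatest) simp
qed

lemma (in wf_digraph) digraph_dist_ge_1:
  assumes "u \<noteq> v" shows "1 \<le> digraph_dist G u v"
  unfolding digraph_dist_eq_INF_length
proof (rule INF_greatest)
  fix p assume "p \<in> {p. awalk u p v}"
  with assms show "1 \<le> ereal (real (length p))"
    by (cases p) (auto simp: awalk_Nil_iff one_ereal_def)
qed

lemma (in wf_digraph) digraph_dist_arc:
  assumes "u \<rightarrow>\<^bsub>G\<^esub> v" "u \<noteq> v" shows "digraph_dist G u v = 1"
proof (rule antisym)
  from assms obtain e where "e \<in> arcs G" "tail G e = u" "head G e = v" by auto
  then have "awalk u [e] v" using arc_implies_awalk by (auto simp: arc_to_ends_def)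
  from digraph_dist_le_length[OF this] show "digraph_dist G u v \<le> 1"
    by (simp add: one_ereal_def)
qed (rule digraph_dist_ge_1[OF assms(2)])

lemma (in wf_digraph) digraph_dist_ge_2:
  assumes "u \<noteq> v" "\<not> u \<rightarrow>\<^bsub>G\<^esub> v" shows "2 \<le> digraph_dist G u v"
  unfolding digraph_dist_eq_INF_length
proof (rule INF_greatest)
  fix p assume "p \<in> {p. awalk u p v}"
  then have p: "awalk u p v" by simp
  have "length p \<noteq> 0" using p assms(1) by (auto simp: awalk_Nil_iff)
  moreover have "length p \<noteq> 1"
  proof
    assume "length p = 1"
    then obtain e where "p = [e]" by (auto simp: length_Suc_conv)
    with p have "e \<in> arcs G" "arc_to_ends G e = (u, v)"
      by (auto simp: awalk_Cons_iff awalk_Nil_iff arc_to_ends_def)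
    with assms(2) show False by (auto dest: dominatesI)
  qed
  ultimately have "2 \<le> length p" by linarith
  then show "2 \<le> ereal (real (length p))"
    by (metis ereal_less_eq(3) numeral_eq_ereal of_nat_le_iff of_nat_numeral)
qed

lemma digraph_dist_le_diameter:
  "\<lbrakk>u \<in> verts G; v \<in> verts G\<rbrakk> \<Longrightarrow> digraph_dist G u v \<le> diameter G"
  unfolding diameter_def by (rule SUP_upper2[of "(u, v)"]) auto

lemma (in wf_digraph) digraph_dist_diameter_2:
  assumes "diameter G = 2" "u \<in> verts G" "v \<in> verts G" "u \<noteq> v"
  shows "digraph_dist G u v = (if u \<rightarrow>\<^bsub>G\<^esub> v then 1 else 2)"
  using digraph_dist_arc digraph_dist_ge_2 digraph_dist_le_diameter[of u G v] assms
  by (auto intro: antisym)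

text \<open>On at most one vertex, \<open>diameter G\<close> is \<open>0\<close> or the supremum \<open>-\<infinity>\<close> of the empty set.\<close>

lemma (in digraph) two_le_card_verts:
  assumes "diameter G = 2" shows "2 \<le> card (verts G)"
proof (rule ccontr)
  assume "\<not> 2 \<le> card (verts G)"
  then have "\<And>u v. \<lbrakk>u \<in> verts G; v \<in> verts G\<rbrakk> \<Longrightarrow> u = v"
    using card_le_Suc0_iff_eq[OF finite_verts] by auto
  then have "diameter G \<le> 0"
    unfolding diameter_def
    by (intro SUP_least) (use digraph_dist_self in \<open>fastforce intro: order_eq_refl\<close>)
  with assms show False by simp
qed

text \<open>Distance \<open>1\<close>
  characterises the arcs, and in a tournament the direction of its arc with \<open>z\<close> determines
  \<open>\<chi>(x, z)\<close>. In particular probes at \<open>x\<close> or \<open>y\<close> themselves always separate the two.\<close>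

lemma (in tournament) equidistant_in_same_set:
  assumes V: "x \<in> verts G" "y \<in> verts G" "z \<in> verts G" and "x \<noteq> y"
    and eq: "digraph_dist G z x = digraph_dist G z y"
  shows "z \<in> same_set G x y"
proof -
  have "z \<noteq> x" using digraph_dist_ge_1[of z y] digraph_dist_self[of z] assms by auto
  moreover have "z \<noteq> y" using digraph_dist_ge_1[of z x] digraph_dist_self[of z] assms by auto
  moreover have "(z \<rightarrow>\<^bsub>G\<^esub> x) = (z \<rightarrow>\<^bsub>G\<^esub> y)"
  proof -
    have "\<not> (2::ereal) \<le> 1" by simp
    then show ?thesis
      using digraph_dist_arc digraph_dist_ge_2 eq \<open>z \<noteq> x\<close> \<open>z \<noteq> y\<close> by metis
  qed
  ultimately show ?thesis
    using V one_arc[of z x] one_arc[of z y] by (auto simp: same_set_def chi_def)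
qed


section \<open>Resolving lists and the upper bound\<close>

text \<open>The cops repeat one list of probes, but need it only once: distinct vertices answer it differently,
  so round \<open>0\<close> already locates the robber.\<close>

lemma cops_win_if_resolving:
  assumes "length us = k" "set us \<subseteq> verts G"
    and inj: "inj_on (\<lambda>x. map (\<lambda>u. digraph_dist G u x) us) (verts G)"
  shows "cops_win G k"
  unfolding cops_win_def
proof (intro exI conjI allI impI)
  let ?\<sigma> = "\<lambda>_. us"
  show "cop_strategy G k ?\<sigma>" using assms by (simp add: cop_strategy_def)
  fix x assume x: "robber_play G x"
  show "possible_positions G ?\<sigma> x 0 = {x 0}"
  proof
    show "{x 0} \<subseteq> possible_positions G ?\<sigma> x 0"
      using x by (auto simp: possible_positions_def)
    show "possible_positions G ?\<sigma> x 0 \<subseteq> {x 0}"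
      using x inj_onD[OF inj] by (fastforce simp: possible_positions_def robber_play_def)
  qed
qed

text \<open>The first-moment method with the expectation taken greedily. Here \<open>U p\<close> collects the choices
  that are useless for \<open>p\<close>; averaging over \<open>z \<in> V\<close> finds a choice that is useless for at most a proportion
  \<open>q\<close> of the elements still left, and each further choice gains another factor \<open>q\<close>.\<close>

lemma exists_list_confined_to_few:
  fixes U :: "'p \<Rightarrow> 'a set" and q :: real
  assumes "finite V" "V \<noteq> {}" "finite P" "0 \<le> q"
    and q: "\<And>p. p \<in> P \<Longrightarrow> real (card (V \<inter> U p)) \<le> q * real (card V)"
  shows "\<exists>us. length us = k \<and> set us \<subseteq> V \<and>
           real (card {p \<in> P. set us \<subseteq> U p}) \<le> q ^ k * real (card P)"
proof (induction k)
  case 0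
  then show ?case by simp
next
  case (Suc k)
  then obtain us where us: "length us = k" "set us \<subseteq> V"
      and le: "real (card {p \<in> P. set us \<subseteq> U p}) \<le> q ^ k * real (card P)" by blast
  define Q where "Q = {p \<in> P. set us \<subseteq> U p}"
  have fQ: "finite Q" using assms by (simp add: Q_def)
  have "\<exists>z\<in>V. real (card {p \<in> Q. z \<in> U p}) \<le> q * real (card Q)"
  proof (rule ccontr)
    assume "\<not> ?thesis"
    then have "(\<Sum>z\<in>V. q * real (card Q)) < (\<Sum>z\<in>V. real (card {p \<in> Q. z \<in> U p}))"
      using assms(1,2) by (intro sum_strict_mono) (auto simp: not_le)
    also have "\<dots> = (\<Sum>z\<in>V. \<Sum>p\<in>{p \<in> Q. z \<in> U p}. 1)" by simp
    also have "\<dots> = (\<Sum>p\<in>Q. \<Sum>z\<in>{z \<in> V. z \<in> U p}. 1)"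
      by (rule sum.swap_restrict[OF assms(1) fQ])
    also have "\<dots> = (\<Sum>p\<in>Q. real (card (V \<inter> U p)))" by (simp add: Int_def)
    also have "\<dots> \<le> (\<Sum>p\<in>Q. q * real (card V))"
      by (rule sum_mono) (use q in \<open>auto simp: Q_def\<close>)
    finally show False by (simp add: algebra_simps)
  qed
  then obtain z where z: "z \<in> V" "real (card {p \<in> Q. z \<in> U p}) \<le> q * real (card Q)" by blast
  have "{p \<in> P. set (z # us) \<subseteq> U p} = {p \<in> Q. z \<in> U p}" by (auto simp: Q_def)
  then have "real (card {p \<in> P. set (z # us) \<subseteq> U p}) \<le> q * real (card Q)"
    using z by simp
  also have "\<dots> \<le> q * (q ^ k * real (card P))"
    using le \<open>0 \<le> q\<close> by (intro mult_left_mono) (auto simp: Q_def)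
  finally show ?case using us z(1)
    by (intro exI[of _ "z # us"]) (simp add: mult.assoc)
qed

lemma (in tournament) cops_win_if_expected_pairs_lt_1:
  fixes q :: real
  assumes "verts G \<noteq> {}" "0 \<le> q"
    and s: "\<And>x y. \<lbrakk>x \<in> verts G; y \<in> verts G; x \<noteq> y\<rbrakk> \<Longrightarrow>
              real (same_count G x y) \<le> q * real (card (verts G))"
    and few: "q ^ k * real (card (verts G) choose 2) < 1"
  shows "cops_win G k"
proof -
  \<comment> \<open>Unordered pairs: ordered ones would double the count and break the bound below \<open>1\<close>.\<close>
  define P where "P = {X. X \<subseteq> verts G \<and> card X = 2}"
  define U where
    "U X = {z. \<forall>x\<in>X. \<forall>y\<in>X. digraph_dist G z x = digraph_dist G z y}" for X
  have P: "finite P" "card P = card (verts G) choose 2"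
    by (auto simp: P_def n_subsets)
  have "real (card (verts G \<inter> U X)) \<le> q * real (card (verts G))" if "X \<in> P" for X
  proof -
    from that obtain x y where X: "X = {x, y}" "x \<noteq> y" "x \<in> verts G" "y \<in> verts G"
      by (auto simp: P_def card_2_iff)
    have "verts G \<inter> U X \<subseteq> same_set G x y"
      using X equidistant_in_same_set by (auto simp: U_def)
    then have "card (verts G \<inter> U X) \<le> same_count G x y"
      unfolding same_count_def by (intro card_mono) (auto simp: same_set_def)
    with s[OF X(3,4,2)] show ?thesis by linarith
  qed
  from exists_list_confined_to_few[where U = U and k = k, OF finite_verts assms(1) P(1) assms(2) this]
  obtain us where us: "length us = k" "set us \<subseteq> verts G"
    and le: "real (card {X \<in> P. set us \<subseteq> U X}) \<le> q ^ k * real (card P)"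
    by blast
  from le few P(2) have "card {X \<in> P. set us \<subseteq> U X} = 0" by simp
  then have none: "{X \<in> P. set us \<subseteq> U X} = {}" using P(1) by simp
  show ?thesis
  proof (rule cops_win_if_resolving[OF us], rule inj_onI, rule ccontr)
    fix x y assume xy: "x \<in> verts G" "y \<in> verts G" "x \<noteq> y"
      and "map (\<lambda>u. digraph_dist G u x) us = map (\<lambda>u. digraph_dist G u y) us"
    then have "\<forall>u\<in>set us. digraph_dist G u x = digraph_dist G u y" by simp
    then have "set us \<subseteq> U {x, y}" by (auto simp: U_def)
    moreover have "{x, y} \<in> P" using xy by (simp add: P_def)
    ultimately show False using none by blast
  qed
qed

text \<open>The number of cops is the floor of the bound. Rounding down costs at most a factor \<open>1 / q \<le> 2\<close> in
  \<open>q ^ k\<close>, which the factor \<open>1 / 2\<close> in \<open>n choose 2\<close> absorbs.\<close>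

lemma (in tournament) cops_win_upper:
  fixes q :: real
  assumes "diameter G = 2" and q: "1 / 2 \<le> q" "q < 1"
    and s: "\<And>x y. \<lbrakk>x \<in> verts G; y \<in> verts G; x \<noteq> y\<rbrakk> \<Longrightarrow>
              real (same_count G x y) \<le> q * real (card (verts G))"
  shows "\<exists>k>0. cops_win G k \<and> real k \<le> - 2 / log 2 q * log 2 (real (card (verts G)))"
proof -
  define n where "n = card (verts G)"
  define L where "L = - 2 / log 2 q * log 2 (real n)"
  define k where "k = nat \<lfloor>L\<rfloor>"
  have n: "2 \<le> n" using two_le_card_verts[OF assms(1)] by (simp add: n_def)
  have lq: "log 2 q < 0" "-1 \<le> log 2 q"
    using q log_le_cancel_iff[of 2 "1/2" q] by (auto simp: log_divide)
  then have "2 \<le> - 2 / log 2 q" by (simp add: field_simps)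
  moreover have "1 \<le> log 2 (real n)" using n by (simp add: le_log_iff)
  ultimately have "2 * 1 \<le> L" unfolding L_def using lq(1) by (intro mult_mono) auto
  then have L: "2 \<le> L" by simp
  have k: "0 < k" "real k \<le> L" "L - 1 < real k" using L unfolding k_def by linarith+
  have "q powr L = 2 powr (log 2 q * L)" using q by (simp add: powr_powr[symmetric])
  also have "log 2 q * L = - (log 2 (real n) + log 2 (real n))" using lq by (simp add: L_def)
  also have "2 powr \<dots> = 1 / (real n * real n)"
    unfolding powr_minus powr_add using n by (simp add: inverse_eq_divide)
  finally have qL: "q powr L = 1 / (real n * real n)" .
  have "q ^ k = q powr real k" using q by (simp add: powr_realpow)
  also have "\<dots> \<le> q powr (L - 1)" using q k by (intro powr_mono') auto
  also have "\<dots> = q powr L / q" using q by (simp add: powr_diff)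
  also have "\<dots> \<le> 2 / (real n * real n)" using q n unfolding qL by (simp add: field_simps)
  finally have "q ^ k * real (n choose 2) \<le> 2 / (real n * real n) * real (n choose 2)"
    by (rule mult_right_mono) simp
  also have "\<dots> = (real n - 1) / real n"
    using n by (simp add: choose_two real_of_nat_div of_nat_diff field_simps)
  also have "\<dots> < 1" using n by (simp add: field_simps)
  finally have "q ^ k * real (card (verts G) choose 2) < 1" by (simp add: n_def)
  moreover have "verts G \<noteq> {}" using n by (auto simp: n_def)
  ultimately have "cops_win G k" using q by (intro cops_win_if_expected_pairs_lt_1[OF _ _ s]) auto
  with k show ?thesis by (auto simp: L_def n_def)
qed


section \<open>A robber who always keeps two possible positions\<close>

definition out_nbrs :: "('a,'b) pre_digraph \<Rightarrow> 'a \<Rightarrow> 'a set" where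
  "out_nbrs G v = {x. v \<rightarrow>\<^bsub>G\<^esub> x}"

lemma (in wf_digraph) out_nbrs_subset: "out_nbrs G v \<subseteq> verts G"
  by (auto simp: out_nbrs_def)

lemma answers_cong:
  "(\<And>s. s < t \<Longrightarrow> x s = y s) \<Longrightarrow> answers G \<sigma> x t = answers G \<sigma> y t"
  by (induction t) auto

text \<open>The distance \<open>0\<close> occurs only at the at most \<open>k\<close> probed vertices. Setting these aside keeps the
  answers in \<open>{1, 2}\<close>, so that \<open>2 ^ k\<close> and not \<open>3 ^ k\<close> bounds their number.\<close>

lemma (in digraph) two_positions_same_answer:
  assumes "diameter G = 2" "set us \<subseteq> verts G" "length us = k" "A \<subseteq> verts G"
    and "2 ^ k + k < card A"
  shows "\<exists>x\<in>A. \<exists>y\<in>A. x \<noteq> y \<and>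
           map (\<lambda>u. digraph_dist G u x) us = map (\<lambda>u. digraph_dist G u y) us"
proof -
  let ?f = "\<lambda>x. map (\<lambda>u. digraph_dist G u x) us"
  let ?T = "{xs. set xs \<subseteq> {1, 2 :: ereal} \<and> length xs = k}"
  have fA: "finite A" using assms(4) finite_verts by (rule finite_subset)
  have "card (set us) \<le> k" using card_length[of us] assms(3) by simp
  then have "2 ^ k < card (A - set us)"
    using assms(5) diff_card_le_card_Diff[of "set us" A] by simp
  moreover have "?f ` (A - set us) \<subseteq> ?T"
  proof -
    have "digraph_dist G u x \<in> {1, 2}" if "x \<in> A - set us" "u \<in> set us" for x u
    proof -
      have "u \<in> verts G" "x \<in> verts G" "u \<noteq> x" using that assms(2,4) by auto
      then show ?thesis using digraph_dist_diameter_2[OF assms(1)] by simp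
    qed
    then have "\<forall>x\<in>A - set us. \<forall>u\<in>set us. digraph_dist G u x \<in> {1, 2}" by blast
    then show ?thesis
      using assms(3) by (intro image_subsetI CollectI conjI) (auto simp del: insert_iff)
  qed
  then have "card (?f ` (A - set us)) \<le> card ?T"
    by (intro card_mono finite_lists_length_eq) auto
  moreover have "card ?T = 2 ^ k" by (simp add: card_lists_length_eq card_insert_if numeral_2_eq_2)
  ultimately have "\<not> inj_on ?f (A - set us)" by (intro pigeonhole) simp
  then show ?thesis unfolding inj_on_def by blast
qed

text \<open>The cops' next probe depends only on the answers so far, so the robber may look ahead to it. From
  each position he keeps two candidates for the next one that lie in \<open>B\<close> and answer that probe alike,
  and moves to one of them. In round \<open>t\<close> the play that deviates to the other candidate is
  consistent with all answers, hence the cops never have a unique possible position.\<close>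

lemma (in digraph) not_cops_win_if_out_degrees:
  assumes diam: "diameter G = 2" and B: "B \<noteq> {}" "B \<subseteq> verts G"
    and deg: "\<And>v. v \<in> B \<Longrightarrow> 2 ^ k + k < card (out_nbrs G v \<inter> B)"
  shows "\<not> cops_win G k"
proof
  assume "cops_win G k"
  then obtain \<sigma> where \<sigma>: "cop_strategy G k \<sigma>"
    and win: "\<And>x. robber_play G x \<Longrightarrow> \<exists>t v. possible_positions G \<sigma> x t = {v}"
    unfolding cops_win_def by blast
  define reply where "reply h x = map (\<lambda>u. digraph_dist G u x) (\<sigma> h)" for h x
  have step: "\<exists>x\<in>B. \<exists>y\<in>B. v \<rightarrow>\<^bsub>G\<^esub> x \<and> v \<rightarrow>\<^bsub>G\<^esub> y \<and> x \<noteq> y \<and> reply h x = reply h y"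
    if "v \<in> B" for v h
  proof -
    have "out_nbrs G v \<inter> B \<subseteq> verts G" using B(2) by blast
    moreover have "length (\<sigma> h) = k" "set (\<sigma> h) \<subseteq> verts G"
      using \<sigma> by (auto simp: cop_strategy_def)
    ultimately have "\<exists>x\<in>out_nbrs G v \<inter> B. \<exists>y\<in>out_nbrs G v \<inter> B. x \<noteq> y \<and> reply h x = reply h y"
      unfolding reply_def using deg[OF that] by (intro two_positions_same_answer[OF diam])
    then show ?thesis unfolding out_nbrs_def by blast
  qed
  \<comment> \<open>States \<open>(x, y, h)\<close>: the robber's position, its indistinguishable twin, and the answers received
    before the probe of the current round.\<close>
  define twin where "twin = (\<lambda>h x y. x \<in> B \<and> y \<in> B \<and> x \<noteq> y \<and> reply h x = reply h y)"
  define ok where "ok = (\<lambda>t (x, y, h). twin h x y \<and> (t = (0::nat) \<longrightarrow> h = []))"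
  define next_state where
    "next_state = (\<lambda>_::nat. \<lambda>(x, y::'a, h) (x', y', h').
       h' = h @ [reply h x] \<and> x \<rightarrow>\<^bsub>G\<^esub> x' \<and> x \<rightarrow>\<^bsub>G\<^esub> y')"
  have "\<exists>f. \<forall>t. ok t (f t) \<and> next_state t (f t) (f (Suc t))"
  proof (rule dependent_nat_choice)
    from B obtain v where "v \<in> B" by blast
    then show "\<exists>st. ok 0 st"
      using step[of v "[]"] by (fastforce simp: ok_def twin_def)
    fix st t assume "ok t st"
    obtain x y h where st: "st = (x, y, h)" by (cases st)
    with \<open>ok t st\<close> have "x \<in> B" by (simp add: ok_def twin_def)
    from step[OF this, of "h @ [reply h x]"]
    show "\<exists>st'. ok (Suc t) st' \<and> next_state t st st'"
      by (fastforce simp: ok_def twin_def next_state_def st)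
  qed
  then obtain f where f: "\<And>t. ok t (f t)" "\<And>t. next_state t (f t) (f (Suc t))" by blast
  define x y h where "x t = fst (f t)" "y t = fst (snd (f t))" "h t = snd (snd (f t))" for t
  have f_eq: "f t = (x t, y t, h t)" for t by (simp add: x_y_h_def)
  have tw: "twin (h t) (x t) (y t)" for t using f(1)[of t] by (simp add: ok_def f_eq)
  have h0: "h 0 = []" using f(1)[of 0] by (simp add: ok_def f_eq)
  have nx: "h (Suc t) = h t @ [reply (h t) (x t)]"
      "x t \<rightarrow>\<^bsub>G\<^esub> x (Suc t)" "x t \<rightarrow>\<^bsub>G\<^esub> y (Suc t)" for t
    using f(2)[of t] by (simp_all add: next_state_def f_eq)
  have h: "answers G \<sigma> x t = h t" for t
    by (induction t) (simp_all add: h0 nx(1) reply_def)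
  have xV: "x 0 \<in> verts G" using tw[of 0] B by (auto simp: twin_def)
  have x_play: "robber_play G x" using xV nx by (simp add: robber_play_def)
  then obtain t v where tv: "possible_positions G \<sigma> x t = {v}" using win by blast
  \<comment> \<open>The play \<open>x'\<close> follows \<open>x\<close>, deviates to the twin in round \<open>t\<close>, and then stays there.\<close>
  define x' where "x' s = (if s < t then x s else y t)" for s
  have "x' s = x' (Suc s) \<or> x' s \<rightarrow>\<^bsub>G\<^esub> x' (Suc s)" for s
  proof (cases "Suc s = t")
    case True
    then show ?thesis using nx(3)[of s] by (auto simp: x'_def)
  qed (use nx(2)[of s] in \<open>auto simp: x'_def\<close>)
  moreover have "x' 0 \<in> verts G" using xV tw[of 0] B by (auto simp: x'_def twin_def)
  ultimately have "robber_play G x'" unfolding robber_play_def by metis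
  moreover have "answers G \<sigma> x' t = h t" unfolding h[symmetric]
    by (rule answers_cong) (simp add: x'_def)
  then have "answers G \<sigma> x' (Suc t) = answers G \<sigma> x (Suc t)"
    using tw[of t] by (simp add: h x'_def twin_def reply_def)
  ultimately have "x' t \<in> possible_positions G \<sigma> x t"
    unfolding possible_positions_def by blast
  moreover have "x t \<in> possible_positions G \<sigma> x t"
    using x_play unfolding possible_positions_def by blast
  ultimately show False using tv tw[of t] by (auto simp: x'_def twin_def)
qed


section \<open>Out-degrees in quasi-random tournaments\<close>

definition in_nbrs :: "('a,'b) pre_digraph \<Rightarrow> 'a \<Rightarrow> 'a set" where
  "in_nbrs G v = {x. x \<rightarrow>\<^bsub>G\<^esub> v}"

definition distinct_pairs :: "'a set \<Rightarrow> ('a \<times> 'a) set" where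
  "distinct_pairs A = {(u, v). u \<in> A \<and> v \<in> A \<and> u \<noteq> v}"

lemma finite_distinct_pairs: "finite A \<Longrightarrow> finite (distinct_pairs A)"
  by (rule finite_subset[of _ "A \<times> A"]) (auto simp: distinct_pairs_def)

lemma card_distinct_pairs:
  assumes "finite A"
  shows "real (card (distinct_pairs A)) = real (card A) * (real (card A) - 1)"
proof -
  have "distinct_pairs A = A \<times> A - (\<lambda>a. (a, a)) ` A" by (auto simp: distinct_pairs_def)
  then have "card (distinct_pairs A) = card (A \<times> A) - card ((\<lambda>a. (a, a)) ` A)"
    using assms by (simp add: card_Diff_subset image_subset_iff)
  also have "\<dots> = card A * card A - card A"
    by (simp add: card_cartesian_product card_image inj_on_def)
  finally show ?thesis
    by (cases "card A") (simp_all add: algebra_simps of_nat_diff)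
qed

lemma (in tournament) finite_nbrs: "finite (out_nbrs G v)" "finite (in_nbrs G v)"
  by (rule finite_subset[OF _ finite_verts], auto simp: out_nbrs_def in_nbrs_def)+

lemma (in tournament) nbrs_partition:
  assumes "v \<in> verts G"
  shows "out_nbrs G v \<inter> in_nbrs G v = {}" "out_nbrs G v \<union> in_nbrs G v = verts G - {v}"
proof -
  have v: "\<not> v \<rightarrow>\<^bsub>G\<^esub> v" using adj_not_same by blast
  have nbr: "x \<in> verts G \<and> x \<noteq> v" if "v \<rightarrow>\<^bsub>G\<^esub> x \<or> x \<rightarrow>\<^bsub>G\<^esub> v" for x
    using that v adj_in_verts by metis
  have arc: "(v \<rightarrow>\<^bsub>G\<^esub> x) \<longleftrightarrow> \<not> (x \<rightarrow>\<^bsub>G\<^esub> v)" if "x \<in> verts G \<and> x \<noteq> v" for x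
    using one_arc[OF assms, of x] that by auto
  show "out_nbrs G v \<inter> in_nbrs G v = {}"
    unfolding out_nbrs_def in_nbrs_def using nbr arc by blast
  show "out_nbrs G v \<union> in_nbrs G v = verts G - {v}"
    unfolding out_nbrs_def in_nbrs_def using nbr arc by blast
qed

lemma (in tournament) card_out_plus_in:
  assumes "v \<in> verts G"
  shows "real (card (out_nbrs G v)) + real (card (in_nbrs G v)) = real (card (verts G)) - 1"
proof -
  have "card (out_nbrs G v) + card (in_nbrs G v) = card (verts G - {v})"
    using card_Un_disjoint[OF finite_nbrs nbrs_partition(1)[OF assms]] nbrs_partition(2)[OF assms]
    by simp
  moreover have "card (verts G) > 0" using assms by (auto simp: card_gt_0_iff)
  ultimately show ?thesis using assms by (simp add: card_Diff_singleton of_nat_diff)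
qed

text \<open>Double counting: \<open>z \<in> S(u, v)\<close> means that \<open>u\<close> and \<open>v\<close> are both out-neighbours or both in-neighbours
  of \<open>z\<close>. So \<open>z\<close> contributes \<open>d\<^sup>+(d\<^sup>+ - 1) + d\<^sup>-(d\<^sup>- - 1)\<close> ordered pairs, and
  \<open>d\<^sup>+ + d\<^sup>- = n - 1\<close> turns this into a function of \<open>d\<^sup>+ - d\<^sup>-\<close> alone.\<close>

lemma (in tournament) sum_same_count:
  defines "n \<equiv> real (card (verts G))"
  shows "(\<Sum>(u, v) \<in> distinct_pairs (verts G). real (same_count G u v)) =
     (\<Sum>z\<in>verts G. (real (card (out_nbrs G z)) - real (card (in_nbrs G z)))\<^sup>2) / 2
     + n * (n - 1)\<^sup>2 / 2 - n * (n - 1)"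
proof -
  let ?D = "distinct_pairs (verts G)"
  let ?R = "\<lambda>(u, v) z. z \<in> same_set G u v"
  have fD: "finite ?D" by (simp add: finite_distinct_pairs)
  have "(\<Sum>(u, v)\<in>?D. real (same_count G u v)) = (\<Sum>p\<in>?D. \<Sum>z\<in>{z \<in> verts G. ?R p z}. 1)"
    by (rule sum.cong) (auto simp: same_count_def same_set_def intro!: arg_cong[where f = card])
  also have "\<dots> = (\<Sum>z\<in>verts G. \<Sum>p\<in>{p \<in> ?D. ?R p z}. 1)"
    by (rule sum.swap_restrict[OF fD finite_verts])
  also have "\<dots> = (\<Sum>z\<in>verts G. (real (card (out_nbrs G z)) - real (card (in_nbrs G z)))\<^sup>2 / 2
      + ((n - 1)\<^sup>2 / 2 - (n - 1)))"
  proof (rule sum.cong)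
    fix z assume z: "z \<in> verts G"
    let ?O = "out_nbrs G z" and ?I = "in_nbrs G z"
    have "(u, v) \<in> {p \<in> ?D. ?R p z} \<longleftrightarrow> (u, v) \<in> distinct_pairs ?O \<union> distinct_pairs ?I" for u v
    proof -
      have "u \<in> ?O \<union> ?I \<longleftrightarrow> u \<in> verts G \<and> u \<noteq> z" "v \<in> ?O \<union> ?I \<longleftrightarrow> v \<in> verts G \<and> v \<noteq> z"
        using nbrs_partition(2)[OF z] by auto
      moreover have "\<not> (u \<in> ?O \<and> u \<in> ?I)" "\<not> (v \<in> ?O \<and> v \<in> ?I)"
        using nbrs_partition(1)[OF z] by auto
      moreover have "chi G u z = chi G v z \<longleftrightarrow> (u \<in> ?I \<longleftrightarrow> v \<in> ?I)"
        by (simp add: chi_def in_nbrs_def)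
      ultimately show ?thesis
        using z by (auto simp: distinct_pairs_def same_set_def)
    qed
    then have "{p \<in> ?D. ?R p z} = distinct_pairs ?O \<union> distinct_pairs ?I" by auto
    moreover have "distinct_pairs ?O \<inter> distinct_pairs ?I = {}"
      using nbrs_partition(1)[OF z] by (auto simp: distinct_pairs_def)
    ultimately have "real (card {p \<in> ?D. ?R p z}) =
        real (card (distinct_pairs ?O)) + real (card (distinct_pairs ?I))"
      using card_Un_disjoint[OF finite_distinct_pairs[OF finite_nbrs(1)]
          finite_distinct_pairs[OF finite_nbrs(2)]] by simp
    also have "\<dots> = real (card ?O) * (real (card ?O) - 1) + real (card ?I) * (real (card ?I) - 1)"
      by (simp add: card_distinct_pairs finite_nbrs)
    also have "\<dots> = (real (card ?O) - real (card ?I))\<^sup>2 / 2 + ((n - 1)\<^sup>2 / 2 - (n - 1))"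
      unfolding n_def card_out_plus_in[OF z, symmetric] by (simp add: power2_eq_square field_simps)
    finally show "(\<Sum>p\<in>{p \<in> ?D. ?R p z}. 1) =
        (real (card ?O) - real (card ?I))\<^sup>2 / 2 + ((n - 1)\<^sup>2 / 2 - (n - 1))" by simp
  qed simp
  finally show ?thesis
    unfolding sum.distrib sum_divide_distrib[symmetric]
    by (simp add: n_def[symmetric] algebra_simps)
qed

text \<open>A vertex with \<open>d\<^sup>+ < n/4\<close> has \<open>d\<^sup>- - d\<^sup>+ \<ge> n - 1 - n/2 \<ge> n/4\<close>, so it contributes at least \<open>n\<^sup>2 / 32\<close>
  to half the sum of the squared differences. That half sum is the deviation of \<open>\<Sum> s(u, v)\<close> from
  \<open>n\<^sup>3 / 2\<close> up to quadratic terms.\<close>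

lemma (in tournament) card_low_out_degree:
  defines "n \<equiv> real (card (verts G))"
  assumes n: "4 \<le> n"
  shows "real (card {z \<in> verts G. real (card (out_nbrs G z)) < n / 4}) * (n\<^sup>2 / 32)
     \<le> (\<Sum>(u, v) \<in> distinct_pairs (verts G). \<bar>real (same_count G u v) - n / 2\<bar>) + 3 / 2 * n\<^sup>2"
proof -
  let ?D = "distinct_pairs (verts G)"
  let ?d = "\<lambda>z. (real (card (out_nbrs G z)) - real (card (in_nbrs G z)))\<^sup>2"
  define S where "S = {z \<in> verts G. real (card (out_nbrs G z)) < n / 4}"
  define E where "E = (\<Sum>(u, v) \<in> ?D. \<bar>real (same_count G u v) - n / 2\<bar>)"
  have low: "n\<^sup>2 / 16 \<le> ?d z" if "z \<in> S" for z
  proof -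
    have "real (card (in_nbrs G z)) - real (card (out_nbrs G z)) \<ge> n / 4"
      using that card_out_plus_in[of z] n by (simp add: S_def n_def)
    then have "(n / 4)\<^sup>2 \<le> (real (card (in_nbrs G z)) - real (card (out_nbrs G z)))\<^sup>2"
      using n by (intro power_mono) auto
    then show ?thesis by (simp add: power_divide power2_commute)
  qed
  have "real (card S) * (n\<^sup>2 / 16) = (\<Sum>z\<in>S. n\<^sup>2 / 16)" by simp
  also have "\<dots> \<le> (\<Sum>z\<in>S. ?d z)" using low by (rule sum_mono)
  also have "\<dots> \<le> (\<Sum>z\<in>verts G. ?d z)" by (rule sum_mono2) (auto simp: S_def)
  finally have 1: "real (card S) * (n\<^sup>2 / 32) \<le> (\<Sum>z\<in>verts G. ?d z) / 2" by simp
  have "(\<Sum>(u, v)\<in>?D. real (same_count G u v))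
      \<le> (\<Sum>(u, v)\<in>?D. \<bar>real (same_count G u v) - n / 2\<bar> + n / 2)"
    by (rule sum_mono) auto
  also have "\<dots> = E + n * (n - 1) * (n / 2)"
    by (simp add: E_def case_prod_unfold sum.distrib card_distinct_pairs n_def)
  finally have "(\<Sum>z\<in>verts G. ?d z) / 2
      \<le> E + n * (n - 1) * (n / 2) - n * (n - 1)\<^sup>2 / 2 + n * (n - 1)"
    unfolding sum_same_count by (simp add: n_def)
  also have "\<dots> = E + 3 / 2 * n\<^sup>2 - 3 / 2 * n" by (simp add: power2_eq_square field_simps)
  finally show ?thesis using 1 n unfolding S_def E_def by linarith
qed

text \<open>The constants let at most \<open>n/8\<close> vertices have out-degree below \<open>n/4\<close>:
  \<open>32 (n/512 + n/512) = n/8\<close>, where \<open>n \<ge> 768\<close> bounds the quadratic error \<open>(3/2) n\<^sup>2\<close> by \<open>n\<^sup>3 / 512\<close>. Each other vertex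
  keeps \<open>n/8\<close> out-neighbours of its kind, against \<open>2 ^ k + k < 2 \<cdot> 2 ^ k \<le> n/16\<close>.\<close>

lemma (in tournament) not_cops_win_log:
  defines "n \<equiv> real (card (verts G))"
  assumes diam: "diameter G = 2" and n: "768 \<le> n"
    and E: "(\<Sum>(u, v) \<in> distinct_pairs (verts G). \<bar>real (same_count G u v) - n / 2\<bar>) \<le> n ^ 3 / 512"
    and k: "real k \<le> log 2 n - 5"
  shows "\<not> cops_win G k"
proof -
  define S where "S = {z \<in> verts G. real (card (out_nbrs G z)) < n / 4}"
  have S: "S \<subseteq> verts G" "finite S" by (auto simp: S_def)
  have "real (card S) * (n\<^sup>2 / 32) \<le> n ^ 3 / 512 + 3 / 2 * n\<^sup>2"
    using card_low_out_degree E n unfolding S_def n_def by linarith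
  also have "\<dots> \<le> n ^ 3 / 512 + n ^ 3 / 512"
  proof -
    have "768 * n\<^sup>2 \<le> n * n\<^sup>2" using n by (intro mult_right_mono) auto
    also have "n * n\<^sup>2 = n ^ 3" by (simp add: power2_eq_square power3_eq_cube)
    finally show ?thesis by simp
  qed
  also have "\<dots> = n / 8 * (n\<^sup>2 / 32)" by (simp add: power2_eq_square power3_eq_cube)
  finally have cS: "real (card S) \<le> n / 8" using n by simp
  have "2 ^ k = (2 :: real) powr real k" by (simp add: powr_realpow)
  also have "\<dots> \<le> 2 powr (log 2 n - 5)" using k by simp
  also have "\<dots> = n / 32" using n by (simp add: powr_diff)
  finally have k2: "(2 :: real) ^ k \<le> n / 32" .
  have "real k < 2 ^ k" by (metis less_exp of_nat_less_iff of_nat_numeral of_nat_power)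
  moreover have "real (2 ^ k + k) = 2 ^ k + real k" by simp
  ultimately have small: "real (2 ^ k + k) < n / 8" using k2 n by linarith
  have "real (card S) < n" using cS n by simp
  then have "S \<noteq> verts G" by (auto simp: n_def)
  show ?thesis
  proof (rule not_cops_win_if_out_degrees[OF diam, of "verts G - S"])
    fix v assume v: "v \<in> verts G - S"
    then have "n / 4 \<le> real (card (out_nbrs G v))" by (auto simp: S_def)
    moreover have "out_nbrs G v \<inter> (verts G - S) = out_nbrs G v - S"
      using out_nbrs_subset by blast
    moreover have "card (out_nbrs G v) - card S \<le> card (out_nbrs G v - S)"
      by (rule diff_card_le_card_Diff[OF S(2)])
    ultimately have "n / 8 \<le> real (card (out_nbrs G v \<inter> (verts G - S)))"
      using cS by simp
    with small show "2 ^ k + k < card (out_nbrs G v \<inter> (verts G - S))"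
      by linarith
  qed (use S \<open>S \<noteq> verts G\<close> in auto)
qed


lemma log2_at_top: "filterlim (\<lambda>x::real. log 2 x) at_top at_top"
  unfolding log_def divide_inverse
  by (subst mult.commute, rule filterlim_tendsto_pos_mult_at_top[OF tendsto_const _ ln_at_top]) simp


section \<open>The localization number\<close>

lemma
  assumes "0 < k" "cops_win G k"
  shows localization_number_le: "localization_number G \<le> k"
    and cops_win_localization_number: "cops_win G (localization_number G)"
proof -
  show "localization_number G \<le> k"
    unfolding localization_number_def by (rule Least_le) (use assms in simp)
  show "cops_win G (localization_number G)"
    unfolding localization_number_def by (rule LeastI2[of _ k]) (use assms in auto)
qed

theorem theorem17:
  fixes G :: "nat \<Rightarrow> ('a,'b) pre_digraph" and \<epsilon> :: real
  assumes "quasi_random G"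
    and "\<And>i. diameter (G i) = 2"
    and "0 < \<epsilon>" and "\<epsilon> < 1"
    and "\<And>i x y. \<lbrakk>x \<in> verts (G i); y \<in> verts (G i); x \<noteq> y\<rbrakk> \<Longrightarrow>
           real (same_count (G i) x y) \<le> \<epsilon> * real (card (verts (G i)))"
  shows "(\<exists>\<delta> :: nat \<Rightarrow> real. \<delta> \<in> o[sequentially](\<lambda>_. 1) \<and>
            (\<forall>i. (1 + \<delta> i) * log 2 (real (card (verts (G i))))
                   \<le> real (localization_number (G i)))) \<and>
         (\<forall>i. real (localization_number (G i))
                \<le> max (- 2 / log 2 \<epsilon>) 2 * log 2 (real (card (verts (G i)))))"
proof -
  define n where "n i = real (card (verts (G i)))" for i
  define \<zeta> where "\<zeta> i = real (localization_number (G i))" for i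
  have tour: "tournament (G i)" for i using assms(1) by (simp add: quasi_random_def)
  have n2: "2 \<le> n i" for i
  proof -
    interpret tournament "G i" by (rule tour)
    show ?thesis using two_le_card_verts[OF assms(2)] by (simp add: n_def)
  qed
  then have log_pos: "0 < log 2 (n i)" for i by (smt (verit) zero_less_log_cancel_iff)
  \<comment> \<open>For \<open>\<epsilon> < 1/2\<close> the rate \<open>-2 / log\<^sub>2 q\<close> is the second argument \<open>2\<close> of the maximum.\<close>
  define q where "q = max \<epsilon> (1 / 2)"
  have q: "1 / 2 \<le> q" "q < 1" "\<epsilon> \<le> q" using assms(4) by (auto simp: q_def)
  have "log 2 (1 / 2 :: real) = -1" by (simp add: log_divide)
  then have q_bound: "- 2 / log 2 q \<le> max (- 2 / log 2 \<epsilon>) 2"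
    by (simp add: q_def max_def)
  have win: "\<exists>k>0. cops_win (G i) k \<and> real k \<le> - 2 / log 2 q * log 2 (n i)" for i
  proof -
    interpret tournament "G i" by (rule tour)
    have "real (same_count (G i) x y) \<le> q * real (card (verts (G i)))"
      if "x \<in> verts (G i)" "y \<in> verts (G i)" "x \<noteq> y" for x y
      using assms(5)[OF that] mult_right_mono[OF q(3), of "real (card (verts (G i)))"] by linarith
    from cops_win_upper[OF assms(2) q(1,2) this] show ?thesis by (simp add: n_def)
  qed
  have upper: "\<zeta> i \<le> max (- 2 / log 2 \<epsilon>) 2 * log 2 (n i)" for i
  proof -
    obtain k where "0 < k" "cops_win (G i) k" "real k \<le> - 2 / log 2 q * log 2 (n i)"
      using win by blast
    moreover from this have "\<zeta> i \<le> real k" by (simp add: \<zeta>_def localization_number_le)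
    ultimately show ?thesis
      using mult_right_mono[OF q_bound, of "log 2 (n i)"] log_pos[of i] by linarith
  qed

  have n_inf: "filterlim n at_top sequentially"
    unfolding n_def
    by (rule filterlim_compose[OF filterlim_real_sequentially])
      (use assms(1) in \<open>simp add: quasi_random_def\<close>)
  define E where "E i = (\<Sum>(u, v) \<in> distinct_pairs (verts (G i)).
      \<bar>real (same_count (G i) u v) - n i / 2\<bar>)" for i
  have "E \<in> o(\<lambda>i. n i ^ 3)"
    using assms(1) unfolding quasi_random_def E_def n_def distinct_pairs_def by simp
  then have "\<forall>\<^sub>F i in sequentially. norm (E i) \<le> 1 / 512 * norm (n i ^ 3)"
    by (rule landau_o.smallD) simp
  moreover have "\<forall>\<^sub>F i in sequentially. 768 \<le> n i"
    using n_inf by (simp add: filterlim_at_top)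
  ultimately have lower: "\<forall>\<^sub>F i in sequentially. log 2 (n i) - 5 < \<zeta> i"
  proof eventually_elim
    case (elim i)
    interpret tournament "G i" by (rule tour)
    have "E i \<le> n i ^ 3 / 512" using elim by simp
    then have "\<not> cops_win (G i) k" if "real k \<le> log 2 (n i) - 5" for k
      using not_cops_win_log[OF assms(2), of k] elim(2) that by (simp add: E_def n_def)
    moreover have "cops_win (G i) (localization_number (G i))"
      using win[of i] cops_win_localization_number by blast
    ultimately show ?case unfolding \<zeta>_def by force
  qed

  \<comment> \<open>The minimum with \<open>0\<close> keeps \<open>\<delta>\<close> from following \<open>\<zeta> / log\<^sub>2 n\<close> upwards, where it need not tend to \<open>1\<close>.\<close>
  define \<delta> where "\<delta> i = min 0 (\<zeta> i / log 2 (n i) - 1)" for i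
  have "\<delta> \<in> o(\<lambda>_. 1)"
  proof -
    have "filterlim (\<lambda>i. log 2 (n i)) at_top sequentially"
      by (rule filterlim_compose[OF log2_at_top n_inf])
    then have lim: "(\<lambda>i. - 5 / log 2 (n i)) \<longlonglongrightarrow> 0"
      by (intro tendsto_divide_0[OF tendsto_const]) (rule filterlim_at_top_imp_at_infinity)
    have ge: "\<forall>\<^sub>F i in sequentially. - 5 / log 2 (n i) \<le> \<delta> i"
      using lower
    proof eventually_elim
      case (elim i)
      with log_pos[of i] show ?case by (simp add: \<delta>_def field_simps)
    qed
    have "\<delta> \<longlonglongrightarrow> 0"
      by (rule tendsto_sandwich[OF ge _ lim tendsto_const]) (simp add: \<delta>_def)
    then show ?thesis by (simp add: smalloI_tendsto)
  qed
  moreover have "(1 + \<delta> i) * log 2 (n i) \<le> \<zeta> i" for i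
  proof -
    have "1 + \<delta> i \<le> \<zeta> i / log 2 (n i)" by (simp add: \<delta>_def)
    with log_pos[of i] show ?thesis by (simp add: field_simps)
  qed
  ultimately show ?thesis using upper unfolding n_def \<zeta>_def by blast
qed

end
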